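(* Let $T$ be a (rooted) geodesically complete simplicial tree. Then its end space, with the usual metric at infinity (and assumed to have at least two points), is a pseudo-complete ultrametric space.
   Context: A simplicial tree $T$ is regarded as a metric space with all edges of length 1, with a fixed root vertex $v$. It is geodesically complete if every isometric embedding $f:[0,t]\to T$ with $t>0$, $f(0)=v$, extends to an isometric embedding $\tilde f:[0,\infty)\to T$. The end space of $(T,v)$ is the set of isometric embeddings $f:[0,\infty)\to T$ with $f(0)=v$, with the metric $d(f,f)=0$ and, for $f\ne g$, $d(f,g)=e^{-t_0}$ where $t_0=\sup\{t\ge0: f(t)=g(t)\}$; this is an ultrametric. A metric space $(X,d)$ is ultrametric if $d(x,y)\le\max\{d(x,z),d(z,y)\}$ for all $x,y,z\in X$. Write $B_r(x)=\{p\in X: d(x,p)<r\}$, with $B_\infty(x)=X$. Two different points $x,y\in X$ are partners if $d(x,z)\ge d(x,y)$ and $d(y,z)\ge d(x,y)$ for all $z\in X\smallsetminus\{x,y\}$. A point $x$ is partnered if there is $y\in X$ such that $x,y$ are partners. A point $x$ is pseudopartnered if it is not partnered but there is $y\in X$, $y\ne x$, with $d(x,z)\ge d(x,y)$ for all $z\in X\smallsetminus\{x,y\}$. Given a pseudopartnered point $x$, an $x$-pseudopartnering sequence $(x_n)_{n\ge 1}$ with associated distances $(d_n)_{n\ge1}$ is any sequence obtained inductively as follows: $x_1=x$, $d_1=\infty$. Given $x_n,d_n$: if $|B_{d_n}(x_n)|=1$ or $d_n=0$, put $x_{n+1}=x_n$, $d_{n+1}=0$. If $|B_{d_n}(x_n)|>1$,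 let $I_n=\{d(x_n,z): z\in B_{d_n}(x_n)\smallsetminus\{x_n\}\}$; if $I_n$ has no minimum put $x_{n+1}=x_n$, $d_{n+1}=0$; if $I_n$ has a minimum, choose any $x_{n+1}\in\{z\in X: d(x_n,z)=\min I_n\}$ and put $d_{n+1}=d(x_n,x_{n+1})$. A point $z\in X$ is a pseudolimit of a pseudopartnering sequence $(x_n)$ if $d(z,x_n)=d(x_n,x_{n+1})$ for every $n$. $(X,d)$ is pseudo-complete if for every pseudopartnered point $x\in X$: (i) every $x$-pseudopartnering sequence has a pseudolimit, and (ii) at least one $x$-pseudopartnering sequence has a finite number of pseudolimits. *)

theory Defs
  imports "HOL-Analysis.Analysis"
begin

section \<open>Simplicial trees as metric spaces\<close>

definition simple_graph :: "'a set \<Rightarrow> 'a set set \<Rightarrow> bool" where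
  "simple_graph V E \<longleftrightarrow> E \<subseteq> {{u, w} | u w. u \<in> V \<and> w \<in> V \<and> u \<noteq> w}"

definition walk :: "'a set \<Rightarrow> 'a set set \<Rightarrow> 'a list \<Rightarrow> bool" where
  "walk V E p \<longleftrightarrow> p \<noteq> [] \<and> set p \<subseteq> V \<and> successively (\<lambda>u w. {u, w} \<in> E) p"

definition connected_graph :: "'a set \<Rightarrow> 'a set set \<Rightarrow> bool" where
  "connected_graph V E \<longleftrightarrow>
     V \<noteq> {} \<and> (\<forall>u\<in>V. \<forall>w\<in>V. \<exists>p. walk V E p \<and> hd p = u \<and> last p = w)"

definition cycle :: "'a set \<Rightarrow> 'a set set \<Rightarrow> 'a list \<Rightarrow> bool" where
  "cycle V E c \<longleftrightarrow> walk V E c \<and> distinct c \<and> 3 \<le> length c \<and> {last c, hd c} \<in> E"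

text \<open>No finiteness is assumed: there may be infinitely many vertices, and vertices of
  infinite degree.\<close>

definition simplicial_tree :: "'a set \<Rightarrow> 'a set set \<Rightarrow> bool" where
  "simplicial_tree V E \<longleftrightarrow> simple_graph V E \<and> connected_graph V E \<and> (\<nexists>c. cycle V E c)"

text \<open>The points of the tree are those of the geometric realization of the one-dimensional
  simplicial complex with vertex set \<open>V\<close> and edge set \<open>E\<close>, given by their barycentric
  coordinates. The simplex whose vertices are the nonzero coordinates of a point is the one
  containing it in its interior.\<close>

definition simplices :: "'a set \<Rightarrow> 'a set set \<Rightarrow> 'a set set" where
  "simplices V E = (\<lambda>u. {u}) ` V \<union> E"

definition supp :: "('a \<Rightarrow> real) \<Rightarrow> 'a set" where
  "supp x = {a. x a \<noteq> 0}"

definition realization :: "'a set \<Rightarrow> 'a set set \<Rightarrow> ('a \<Rightarrow> real) set" where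
  "realization V E =
     {x. (\<forall>a. 0 \<le> x a) \<and> supp x \<in> simplices V E \<and> (\<Sum>a\<in>supp x. x a) = 1}"

definition vertex_pt :: "'a \<Rightarrow> 'a \<Rightarrow> real" where
  "vertex_pt u = (\<lambda>a. if a = u then 1 else 0)"

text \<open>The metric is the path metric: the infimum of the lengths of chains of points in which
  any two consecutive points lie in a common closed simplex. Two points with coordinates
  \<open>(1 - s, s)\<close> and \<open>(1 - t, t)\<close> on the same closed edge are at length \<open>\<bar>s - t\<bar>\<close>, so that each
  edge has length 1; this is half of the sum of the coordinate differences.\<close>

definition common_simplex :: "'a set \<Rightarrow> 'a set set \<Rightarrow> ('a \<Rightarrow> real) \<Rightarrow> ('a \<Rightarrow> real) \<Rightarrow> bool" where
  "common_simplex V E x y \<longleftrightarrow> (\<exists>\<sigma>\<in>simplices V E. supp x \<subseteq> \<sigma> \<and> supp y \<subseteq> \<sigma>)"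

definition seg_length :: "('a \<Rightarrow> real) \<Rightarrow> ('a \<Rightarrow> real) \<Rightarrow> real" where
  "seg_length x y = (\<Sum>a\<in>supp x \<union> supp y. \<bar>x a - y a\<bar>) / 2"

definition chain :: "'a set \<Rightarrow> 'a set set \<Rightarrow> ('a \<Rightarrow> real) \<Rightarrow> ('a \<Rightarrow> real) \<Rightarrow> ('a \<Rightarrow> real) list \<Rightarrow> bool" where
  "chain V E x y p \<longleftrightarrow>
     p \<noteq> [] \<and> set p \<subseteq> realization V E \<and> hd p = x \<and> last p = y \<and>
     successively (common_simplex V E) p"

definition chain_length :: "('a \<Rightarrow> real) list \<Rightarrow> real" where
  "chain_length p = (\<Sum>i<length p - 1. seg_length (p ! i) (p ! Suc i))"

definition tree_dist :: "'a set \<Rightarrow> 'a set set \<Rightarrow> ('a \<Rightarrow> real) \<Rightarrow> ('a \<Rightarrow> real) \<Rightarrow> real" where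
  "tree_dist V E x y = Inf {chain_length p | p. chain V E x y p}"

section \<open>Geodesic completeness and the end space\<close>

text \<open>Maps on \<open>I\<close> are taken to be extensional (\<open>undefined\<close> outside \<open>I\<close>), so that two of them are
  equal iff they agree on \<open>I\<close>.\<close>

definition isometric_embeddings ::
    "real set \<Rightarrow> 'p set \<Rightarrow> ('p \<Rightarrow> 'p \<Rightarrow> real) \<Rightarrow> (real \<Rightarrow> 'p) set" where
  "isometric_embeddings I M d =
     {f \<in> I \<rightarrow>\<^sub>E M. \<forall>s\<in>I. \<forall>t\<in>I. d (f s) (f t) = \<bar>s - t\<bar>}"

definition geodesically_complete :: "'a set \<Rightarrow> 'a set set \<Rightarrow> 'a \<Rightarrow> bool" where
  "geodesically_complete V E v \<longleftrightarrow>
     (\<forall>t>0. \<forall>f \<in> isometric_embeddings {0..t} (realization V E) (tree_dist V E).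
        f 0 = vertex_pt v \<longrightarrow>
        (\<exists>g \<in> isometric_embeddings {0..} (realization V E) (tree_dist V E).
           \<forall>s\<in>{0..t}. g s = f s))"

definition end_space :: "'a set \<Rightarrow> 'a set set \<Rightarrow> 'a \<Rightarrow> (real \<Rightarrow> 'a \<Rightarrow> real) set" where
  "end_space V E v =
     {f \<in> isometric_embeddings {0..} (realization V E) (tree_dist V E). f 0 = vertex_pt v}"

definition end_dist :: "(real \<Rightarrow> 'p) \<Rightarrow> (real \<Rightarrow> 'p) \<Rightarrow> real" where
  "end_dist f g = (if f = g then 0 else exp (- Sup {t. 0 \<le> t \<and> f t = g t}))"

section \<open>Pseudo-complete ultrametric spaces\<close>

definition ultrametric_space :: "'p set \<Rightarrow> ('p \<Rightarrow> 'p \<Rightarrow> real) \<Rightarrow> bool" where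
  "ultrametric_space X d \<longleftrightarrow>
     Metric_space X d \<and> (\<forall>x\<in>X. \<forall>y\<in>X. \<forall>z\<in>X. d x y \<le> max (d x z) (d z y))"

text \<open>Open balls with a possibly infinite radius (\<open>Metric_space.mball\<close> allows only real radii).\<close>

definition eball :: "'p set \<Rightarrow> ('p \<Rightarrow> 'p \<Rightarrow> real) \<Rightarrow> 'p \<Rightarrow> ereal \<Rightarrow> 'p set" where
  "eball X d x r = {p \<in> X. ereal (d x p) < r}"

definition partners :: "'p set \<Rightarrow> ('p \<Rightarrow> 'p \<Rightarrow> real) \<Rightarrow> 'p \<Rightarrow> 'p \<Rightarrow> bool" where
  "partners X d x y \<longleftrightarrow>
     x \<in> X \<and> y \<in> X \<and> x \<noteq> y \<and> (\<forall>z \<in> X - {x, y}. d x z \<ge> d x y \<and> d y z \<ge> d x y)"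

definition partnered :: "'p set \<Rightarrow> ('p \<Rightarrow> 'p \<Rightarrow> real) \<Rightarrow> 'p \<Rightarrow> bool" where
  "partnered X d x \<longleftrightarrow> (\<exists>y\<in>X. partners X d x y)"

definition pseudopartnered :: "'p set \<Rightarrow> ('p \<Rightarrow> 'p \<Rightarrow> real) \<Rightarrow> 'p \<Rightarrow> bool" where
  "pseudopartnered X d x \<longleftrightarrow>
     x \<in> X \<and> \<not> partnered X d x \<and>
     (\<exists>y\<in>X. y \<noteq> x \<and> (\<forall>z \<in> X - {x, y}. d x z \<ge> d x y))"

definition dist_values :: "'p set \<Rightarrow> ('p \<Rightarrow> 'p \<Rightarrow> real) \<Rightarrow> 'p \<Rightarrow> ereal \<Rightarrow> real set" where
  "dist_values X d x r = {d x z | z. z \<in> eball X d x r - {x}}"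

definition is_minimum :: "real set \<Rightarrow> real \<Rightarrow> bool" where
  "is_minimum I m \<longleftrightarrow> m \<in> I \<and> (\<forall>i\<in>I. m \<le> i)"

text \<open>\<open>pseudopartnering_step X d x r x' r'\<close>: from the term \<open>x\<close> with associated distance \<open>r\<close>, the
  inductive construction may produce the next term \<open>x'\<close> with associated distance \<open>r'\<close>. The
  condition \<open>card B = 1\<close> fails for infinite \<open>B\<close>, as it should.\<close>

definition pseudopartnering_step ::
    "'p set \<Rightarrow> ('p \<Rightarrow> 'p \<Rightarrow> real) \<Rightarrow> 'p \<Rightarrow> ereal \<Rightarrow> 'p \<Rightarrow> ereal \<Rightarrow> bool" where
  "pseudopartnering_step X d x r x' r' \<longleftrightarrow>
     (if card (eball X d x r) = 1 \<or> r = 0 then x' = x \<and> r' = 0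
      else if \<nexists>m. is_minimum (dist_values X d x r) m then x' = x \<and> r' = 0
      else x' \<in> X \<and> is_minimum (dist_values X d x r) (d x x') \<and> r' = ereal (d x x'))"

text \<open>Sequences are indexed from 1; their value at 0 is irrelevant.\<close>

definition pseudopartnering_seq ::
    "'p set \<Rightarrow> ('p \<Rightarrow> 'p \<Rightarrow> real) \<Rightarrow> 'p \<Rightarrow> (nat \<Rightarrow> 'p) \<Rightarrow> (nat \<Rightarrow> ereal) \<Rightarrow> bool" where
  "pseudopartnering_seq X d x xs ds \<longleftrightarrow>
     xs 1 = x \<and> ds 1 = \<infinity> \<and>
     (\<forall>n\<ge>1. pseudopartnering_step X d (xs n) (ds n) (xs (Suc n)) (ds (Suc n)))"

definition pseudolimit :: "'p set \<Rightarrow> ('p \<Rightarrow> 'p \<Rightarrow> real) \<Rightarrow> (nat \<Rightarrow> 'p) \<Rightarrow> 'p \<Rightarrow> bool" where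
  "pseudolimit X d xs z \<longleftrightarrow> z \<in> X \<and> (\<forall>n\<ge>1. d z (xs n) = d (xs n) (xs (Suc n)))"

definition pseudo_complete :: "'p set \<Rightarrow> ('p \<Rightarrow> 'p \<Rightarrow> real) \<Rightarrow> bool" where
  "pseudo_complete X d \<longleftrightarrow>
     (\<forall>x. pseudopartnered X d x \<longrightarrow>
        (\<forall>xs ds. pseudopartnering_seq X d x xs ds \<longrightarrow> (\<exists>z. pseudolimit X d xs z)) \<and>
        (\<exists>xs ds. pseudopartnering_seq X d x xs ds \<and> finite {z. pseudolimit X d xs z}))"

end

theory Submission
  imports Defs
begin

text \<open>
  Two ends of a tree can separate only at a vertex, and since edges have length 1 and rays start
  at a vertex, they separate at an integer time. So the nonzero distances between ends are
  powers \<open>exp (- N)\<close> with \<open>N\<close> a natural number, which accumulate only at 0. The end space is also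
  complete: a Cauchy sequence of rays is eventually constant on every bounded interval. The
  theorem follows since every complete ultrametric space with distances accumulating only at 0
  is pseudo-complete (lemma \<open>pseudo_complete_if_complete_discrete\<close>): the distances along a
  pseudopartnering sequence decrease strictly until they vanish, hence they tend to 0, and the
  limit of the sequence is its unique pseudolimit.

  The geometric work is to see that every isometric ray, for a metric defined as an infimum over
  chains, runs along the edges of a combinatorial ray with unit speed (lemma \<open>end_space_ray\<close>). It
  suffices to know the distance from
  vertices. The graph distance from a vertex \<open>u\<close>, extended affinely over the edges, changes by at
  most the length of any segment, so it is a lower bound for the distance from \<open>u\<close>; it is
  attained along shortest walks (lemma \<open>tree_dist_vertex\<close>). Here acyclicity enters through two
  consequences: adjacent vertices have different distances from \<open>u\<close>, and every vertex other than
  \<open>u\<close> has only one neighbour closer to \<open>u\<close>. The latter also makes a ray up to a given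
  vertex unique (lemma \<open>ends_agree_up_to_ceiling\<close>), which gives the ultrametric inequality.
\<close>

section \<open>Complete ultrametric spaces with discrete distances\<close>

text \<open>Every term admits a next one, so dependent choice gives a whole sequence.\<close>

lemma pseudopartnering_seq_exists:
  assumes "x \<in> X"
  shows "\<exists>xs ds. pseudopartnering_seq X d x xs ds"
proof -
  have step: "\<exists>q. pseudopartnering_step X d (fst p) (snd p) (fst q) (snd q)" for p
  proof (cases "(card (eball X d (fst p) (snd p)) = 1 \<or> snd p = 0) \<or>
      (\<nexists>m. is_minimum (dist_values X d (fst p) (snd p)) m)")
    case True
    then show ?thesis by (intro exI[of _ "(fst p, 0)"]) (auto simp: pseudopartnering_step_def)
  next
    case False
    then obtain m where m: "is_minimum (dist_values X d (fst p) (snd p)) m" by blast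
    then obtain z where "z \<in> X" "m = d (fst p) z"
      by (auto simp: is_minimum_def dist_values_def eball_def)
    then show ?thesis using False m
      by (intro exI[of _ "(z, ereal m)"]) (auto simp: pseudopartnering_step_def)
  qed
  obtain F where F: "F 0 = (x, \<infinity>)"
    "\<And>n. pseudopartnering_step X d (fst (F n)) (snd (F n)) (fst (F (Suc n))) (snd (F (Suc n)))"
    using dependent_nat_choice[of "\<lambda>n p. n = 0 \<longrightarrow> p = (x, \<infinity>)"
        "\<lambda>n p q. pseudopartnering_step X d (fst p) (snd p) (fst q) (snd q)"] step by auto
  have "pseudopartnering_step X d (fst (F (n - 1))) (snd (F (n - 1)))
      (fst (F (Suc n - 1))) (snd (F (Suc n - 1)))" if "n \<ge> 1" for n
    using F(2)[of "n - 1"] that by simp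
  then have "pseudopartnering_seq X d x (\<lambda>n. fst (F (n - 1))) (\<lambda>n. snd (F (n - 1)))"
    unfolding pseudopartnering_seq_def using F(1) by simp
  then show ?thesis by blast
qed

text \<open>The consecutive distances \<open>e n\<close> of a pseudopartnering sequence decrease strictly until they
  become 0, because the next distance is taken inside the open ball of radius \<open>e n\<close>. If
  distances accumulate only at 0, then \<open>e\<close> tends to 0, which has two consequences. By the
  ultrametric inequality the sequence is Cauchy; as long as \<open>e n\<close> is not 0, its limit lies within \<open>e (n + 1) < e n\<close> of
  \<open>xs (n + 1)\<close>, and hence, all triangles being isosceles, at distance exactly \<open>e n\<close> from \<open>xs n\<close>.
  And two pseudolimits have distance at most \<open>e n\<close> for all \<open>n\<close>, so they coincide. Thus every
  sequence, including one that stops, has exactly one pseudolimit.\<close>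

lemma pseudo_complete_if_complete_discrete:
  assumes um: "ultrametric_space X d"
    and complete: "Metric_space.mcomplete X d"
    and discrete: "\<And>\<epsilon>. 0 < \<epsilon> \<Longrightarrow> finite {r. \<epsilon> \<le> r \<and> (\<exists>x\<in>X. \<exists>y\<in>X. r = d x y)}"
  shows "pseudo_complete X d"
proof -
  interpret Metric_space X d using um by (simp add: ultrametric_space_def)
  have ultra: "d x y \<le> max (d x z) (d z y)" if "x \<in> X" "y \<in> X" "z \<in> X" for x y z
    using um that by (auto simp: ultrametric_space_def)
  have unique_limit: "\<exists>z. {w. pseudolimit X d xs w} = {z}"
    if x: "x \<in> X" and seq: "pseudopartnering_seq X d x xs ds" for x xs ds
  proof -
    define e where "e n = d (xs n) (xs (Suc n))" for n
    have seq_step: "pseudopartnering_step X d (xs n) (ds n) (xs (Suc n)) (ds (Suc n))" if "n \<ge> 1" for n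
      using seq that by (auto simp: pseudopartnering_seq_def)
    have inX: "xs n \<in> X" if "n \<ge> 1" for n
      using that
    proof (induction n rule: dec_induct)
      case base
      then show ?case using seq x by (simp add: pseudopartnering_seq_def)
    next
      case (step n)
      then show ?case using seq_step[of n]
        by (auto simp: pseudopartnering_step_def split: if_splits)
    qed
    have ds_Suc: "ds (Suc n) = ereal (e n)" if "n \<ge> 1" for n
      using seq_step[OF that] inX[OF that]
      by (auto simp: pseudopartnering_step_def e_def zero_ereal_def split: if_splits)
    \<comment> \<open>If the construction does not stop at \<open>Suc n\<close>, then \<open>xs (Suc (Suc n))\<close> lies in the open ball of
      radius \<open>ds (Suc n) = e n\<close> around \<open>xs (Suc n)\<close>.\<close>
    have e_step: "e (Suc n) < e n \<or> e (Suc n) = 0" if "n \<ge> 1" for n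
      using seq_step[of "Suc n"] ds_Suc[OF that] inX[of "Suc n"] that
      by (auto simp: pseudopartnering_step_def e_def is_minimum_def dist_values_def eball_def
          split: if_splits)
    have e_nonneg: "0 \<le> e n" for n by (simp add: e_def)
    have e_antimono: "e m \<le> e n" if "1 \<le> n" "n \<le> m" for n m
      using that(2)
    proof (induction m rule: dec_induct)
      case (step m)
      then show ?case using e_step[of m] that(1) e_nonneg[of n] by auto
    qed simp
    have e_small: "\<exists>n\<ge>1. e n < \<epsilon>" if "0 < \<epsilon>" for \<epsilon>
    proof (rule ccontr)
      assume "\<not> ?thesis"
      then have ge: "\<epsilon> \<le> e n" if "n \<ge> 1" for n using that by force
      have "e (Suc (Suc n)) < e (Suc n)" for n
        using e_step[of "Suc n"] ge[of "Suc (Suc n)"] \<open>0 < \<epsilon>\<close> by auto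
      then have "inj (\<lambda>n. - e (Suc n))"
        by (intro strict_mono_imp_inj_on) (simp add: strict_mono_Suc_iff)
      then have "inj (\<lambda>n. e (Suc n))" by (simp add: inj_on_def)
      moreover have "range (\<lambda>n. e (Suc n)) \<subseteq> {r. \<epsilon> \<le> r \<and> (\<exists>x\<in>X. \<exists>y\<in>X. r = d x y)}"
        using ge inX unfolding e_def by fastforce
      ultimately show False
        using discrete[OF that] finite_subset range_inj_infinite by blast
    qed
    have tail: "d (xs n) (xs m) \<le> e n" if "1 \<le> n" "n \<le> m" for n m
      using that(2)
    proof (induction m rule: dec_induct)
      case base
      then show ?case using inX[OF that(1)] e_nonneg by simp
    next
      case (step m)
      have "d (xs n) (xs (Suc m)) \<le> max (d (xs n) (xs m)) (e m)"
        unfolding e_def using inX that(1) step.hyps by (intro ultra) auto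
      then show ?case using step e_antimono[of n m] that(1) by simp
    qed
    \<comment> \<open>The shift skips the value at 0, which may lie outside \<open>X\<close>.\<close>
    have "MCauchy (\<lambda>n. xs (Suc n))"
      unfolding MCauchy_def
    proof (intro conjI allI impI)
      show "range (\<lambda>n. xs (Suc n)) \<subseteq> X" using inX by auto
      fix \<epsilon> :: real assume "0 < \<epsilon>"
      then obtain N where N: "N \<ge> 1" "e N < \<epsilon>" using e_small by blast
      have "d (xs (Suc n)) (xs (Suc n')) < \<epsilon>" if "N \<le> n" "N \<le> n'" for n n'
        using ultra[of "xs (Suc n)" "xs (Suc n')" "xs N"] tail[of N "Suc n"] tail[of N "Suc n'"]
          inX N that by (auto simp: commute)
      then show "\<exists>N. \<forall>n n'. N \<le> n \<longrightarrow> N \<le> n' \<longrightarrow> d (xs (Suc n)) (xs (Suc n')) < \<epsilon>" by blast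
    qed
    then obtain z where z: "z \<in> X" "\<And>\<epsilon>. 0 < \<epsilon> \<Longrightarrow> \<exists>N. \<forall>n\<ge>N. d (xs (Suc n)) z < \<epsilon>"
      using complete unfolding mcomplete_def limit_metric_sequentially by meson
    \<comment> \<open>All later terms lie in the closed ball of radius \<open>e n\<close>, and so does their limit.\<close>
    have z_le: "d z (xs n) \<le> e n" if "n \<ge> 1" for n
    proof (rule field_le_epsilon)
      fix \<epsilon> :: real assume "0 < \<epsilon>"
      then obtain N where N: "\<forall>m\<ge>N. d (xs (Suc m)) z < \<epsilon>" using z(2) by blast
      define m where "m = Suc (max N n)"
      have "d z (xs n) \<le> max (d z (xs m)) (d (xs m) (xs n))"
        using inX z(1) that by (intro ultra) (auto simp: m_def)
      moreover have "d z (xs m) < \<epsilon>" using N by (simp add: m_def commute)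
      moreover have "d (xs m) (xs n) \<le> e n" using tail[of n m] that by (simp add: m_def commute)
      ultimately show "d z (xs n) \<le> e n + \<epsilon>" using e_nonneg[of n] \<open>0 < \<epsilon>\<close> by linarith
    qed
    have "d z (xs n) = e n" if "n \<ge> 1" for n
    proof (cases "e n = 0")
      case True
      then show ?thesis using z_le[OF that] nonneg[of z "xs n"] by simp
    next
      case False
      have "d z (xs (Suc n)) < e n"
        using z_le[of "Suc n"] e_step[OF that] False e_nonneg[of n] by auto
      moreover have "e n \<le> max (d (xs n) z) (d z (xs (Suc n)))"
        unfolding e_def using inX z(1) that by (intro ultra) auto
      ultimately show ?thesis using z_le[OF that] by (simp add: commute)
    qed
    then have z_lim: "pseudolimit X d xs z" using z(1) by (simp add: pseudolimit_def e_def)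
    have "w = z" if w: "pseudolimit X d xs w" for w
    proof (rule ccontr)
      assume "w \<noteq> z"
      have "w \<in> X" using w by (simp add: pseudolimit_def)
      then have "0 < d w z" using \<open>w \<noteq> z\<close> z(1) by simp
      then obtain n where n: "n \<ge> 1" "e n < d w z" using e_small by blast
      moreover have "d w z \<le> max (d w (xs n)) (d (xs n) z)"
        using \<open>w \<in> X\<close> z(1) inX n(1) by (intro ultra) auto
      moreover have "d w (xs n) = e n" using w n(1) by (simp add: pseudolimit_def e_def)
      moreover have "d (xs n) z = e n" using z_lim n(1) by (simp add: pseudolimit_def e_def commute)
      ultimately show False by simp
    qed
    then have "{w. pseudolimit X d xs w} = {z}" using z_lim by blast
    then show ?thesis ..
  qed
  show ?thesis
    unfolding pseudo_complete_def
  proof (intro allI impI conjI)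
    fix x assume "pseudopartnered X d x"
    then have x: "x \<in> X" by (simp add: pseudopartnered_def)
    show "\<exists>z. pseudolimit X d xs z" if "pseudopartnering_seq X d x xs ds" for xs ds
      using unique_limit[OF x that] by blast
    show "\<exists>xs ds. pseudopartnering_seq X d x xs ds \<and> finite {z. pseudolimit X d xs z}"
      using pseudopartnering_seq_exists[OF x] unique_limit[OF x] by (metis finite.emptyI finite.insertI)
  qed
qed

section \<open>Graph distance in trees\<close>

definition gdist :: "'a set \<Rightarrow> 'a set set \<Rightarrow> 'a \<Rightarrow> 'a \<Rightarrow> nat" where
  "gdist V E u w = (LEAST n. \<exists>p. walk V E p \<and> hd p = u \<and> last p = w \<and> length p = Suc n)"

locale tree =
  fixes V :: "'a set" and E :: "'a set set"
  assumes simplicial_tree: "simplicial_tree V E"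
begin

lemma edgeD:
  assumes "{a, b} \<in> E"
  shows "a \<in> V" "b \<in> V" "a \<noteq> b"
proof -
  have "E \<subseteq> {{u, w} | u w. u \<in> V \<and> w \<in> V \<and> u \<noteq> w}"
    using simplicial_tree by (simp add: simplicial_tree_def simple_graph_def)
  then obtain u w where "{a, b} = {u, w}" "u \<in> V" "w \<in> V" "u \<noteq> w" using assms by blast
  then show "a \<in> V" "b \<in> V" "a \<noteq> b" by (auto simp: doubleton_eq_iff)
qed

lemma edgeE:
  assumes "e \<in> E"
  obtains a b where "e = {a, b}"
  using assms simplicial_tree by (auto simp: simplicial_tree_def simple_graph_def)

lemma gdist_le: "walk V E p \<Longrightarrow> gdist V E (hd p) (last p) \<le> length p - 1"
  unfolding gdist_def
  by (rule Least_le) (auto simp: walk_def intro!: exI[of _ p])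

lemma gdist_walk:
  assumes "u \<in> V" "w \<in> V"
  obtains p where "walk V E p" "hd p = u" "last p = w" "length p = Suc (gdist V E u w)"
proof -
  obtain p where p: "walk V E p" "hd p = u" "last p = w"
    using simplicial_tree assms unfolding simplicial_tree_def connected_graph_def by blast
  then have "\<exists>n p. walk V E p \<and> hd p = u \<and> last p = w \<and> length p = Suc n"
    by (auto simp: walk_def intro!: exI[of _ "length p - 1"] exI[of _ p])
  from LeastI_ex[OF this] show thesis using that unfolding gdist_def by blast
qed

lemma gdist_self: "u \<in> V \<Longrightarrow> gdist V E u u = 0"
  using gdist_le[of "[u]"] by (simp add: walk_def)

lemma gdist_eq_0:
  assumes "u \<in> V" "w \<in> V" "gdist V E u w = 0"
  shows "w = u"
proof -
  obtain p where "hd p = u" "last p = w" "length p = Suc 0"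
    using gdist_walk[OF assms(1,2)] assms(3) by metis
  then show ?thesis by (auto simp: length_Suc_conv)
qed

lemma gdist_edge_le:
  assumes "u \<in> V" "{a, b} \<in> E"
  shows "gdist V E u b \<le> Suc (gdist V E u a)"
proof -
  obtain p where p: "walk V E p" "hd p = u" "last p = a" "length p = Suc (gdist V E u a)"
    using gdist_walk[OF assms(1) edgeD(1)[OF assms(2)]] .
  then have "walk V E (p @ [b])"
    using assms(2) edgeD(2)[OF assms(2)] by (auto simp: walk_def successively_append_iff)
  from gdist_le[OF this] p show ?thesis by (auto simp: walk_def)
qed

text \<open>The vertex before the last one on a shortest walk.\<close>

lemma gdist_parent:
  assumes "u \<in> V" "w \<in> V" "gdist V E u w = Suc n"
  obtains a where "{a, w} \<in> E" "gdist V E u a = n"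
proof -
  obtain p where p: "walk V E p" "hd p = u" "last p = w" "length p = Suc (Suc n)"
    using gdist_walk[OF assms(1,2)] assms(3) by metis
  define q where "q = butlast p"
  have pq: "p = q @ [w]" "length q = Suc n"
    using p by (auto simp: q_def walk_def)
  then have "q \<noteq> []" by auto
  have q: "walk V E q" "hd q = u" "{last q, w} \<in> E"
    using p(1,2) pq(1) \<open>q \<noteq> []\<close> by (auto simp: walk_def successively_append_iff)
  have "gdist V E u (last q) \<le> n" using gdist_le[OF q(1)] q(2) pq(2) by simp
  moreover have "Suc n \<le> Suc (gdist V E u (last q))"
    using gdist_edge_le[OF assms(1) q(3)] assms(3) by simp
  ultimately show thesis using that q(3) by simp
qed

text \<open>The source of all cycles that contradict the tree property. Descend from \<open>a\<close> and from \<open>b\<close>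
  towards \<open>u\<close> in parallel, one level at a time, until the two descending walks first meet.
  The two halves are disjoint before that, because vertices of different levels differ and
  those of the same level have not met yet.\<close>

lemma same_level_path:
  assumes "u \<in> V" "a \<in> V" "b \<in> V" "a \<noteq> b" "gdist V E u a = n" "gdist V E u b = n"
  shows "\<exists>p. walk V E p \<and> distinct p \<and> 3 \<le> length p \<and> hd p = a \<and> last p = b \<and>
             (\<forall>c\<in>set p. gdist V E u c \<le> n)"
  using assms(2-)
proof (induction n arbitrary: a b)
  case 0
  then show ?case using gdist_eq_0[OF assms(1)] by metis
next
  case (Suc n)
  obtain a' where a': "{a', a} \<in> E" "gdist V E u a' = n"
    using gdist_parent[OF assms(1) Suc.prems(1,4)] .
  obtain b' where b': "{b', b} \<in> E" "gdist V E u b' = n"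
    using gdist_parent[OF assms(1) Suc.prems(2,5)] .
  show ?case
  proof (cases "a' = b'")
    case True
    then have "walk V E [a, a', b]" 
      using a' b' edgeD(1)[OF a'(1)] Suc.prems by (auto simp: walk_def insert_commute)
    moreover have "distinct [a, a', b]" using Suc.prems a' b' by auto
    ultimately show ?thesis using Suc.prems a' by (intro exI[of _ "[a, a', b]"]) auto
  next
    case False
    obtain p where p: "walk V E p" "distinct p" "3 \<le> length p" "hd p = a'" "last p = b'"
      "\<forall>c\<in>set p. gdist V E u c \<le> n"
      using Suc.IH[OF edgeD(1)[OF a'(1)] edgeD(1)[OF b'(1)] False a'(2) b'(2)] by blast
    have "walk V E (a # p @ [b])"
      using p a' b' Suc.prems 
      by (auto simp: walk_def successively_append_iff successively_Cons insert_commute)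
    moreover have "distinct (a # p @ [b])" using p Suc.prems by auto
    ultimately show ?thesis using Suc.prems p
      by (intro exI[of _ "a # p @ [b]"]) (auto intro: le_SucI)
  qed
qed

text \<open>An edge between two vertices of the same level would close a path of that level to a cycle.\<close>

lemma gdist_adjacent_neq:
  assumes "u \<in> V" "{a, b} \<in> E"
  shows "gdist V E u a \<noteq> gdist V E u b"
proof
  assume eq: "gdist V E u a = gdist V E u b"
  obtain p where p: "walk V E p" "distinct p" "3 \<le> length p" "hd p = a" "last p = b"
    using same_level_path[OF assms(1) edgeD[OF assms(2)] eq refl] by blast
  then have "cycle V E p" using assms(2) by (simp add: cycle_def insert_commute)
  then show False using simplicial_tree by (auto simp: simplicial_tree_def)
qed

text \<open>Two parents of \<open>c\<close> would be joined by a path below the level of \<open>c\<close>, which \<open>c\<close> closes to a cycle.\<close>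

lemma parent_unique:
  assumes "u \<in> V" "{a, c} \<in> E" "{b, c} \<in> E"
    and lev: "gdist V E u c = Suc (gdist V E u a)" "gdist V E u c = Suc (gdist V E u b)"
  shows "a = b"
proof (rule ccontr)
  assume "a \<noteq> b"
  obtain p where p: "walk V E p" "distinct p" "3 \<le> length p" "hd p = a" "last p = b"
      "\<forall>d\<in>set p. gdist V E u d \<le> gdist V E u a"
    using same_level_path[OF assms(1) edgeD(1)[OF assms(2)] edgeD(1)[OF assms(3)] \<open>a \<noteq> b\<close> refl] lev
    by auto
  have "c \<notin> set p" using p(6) lev by auto
  moreover have "walk V E (p @ [c])"
    using p assms(3) edgeD(2)[OF assms(2)] by (auto simp: walk_def successively_append_iff)
  ultimately have "cycle V E (p @ [c])" using p assms(2)
    by (auto simp: cycle_def insert_commute walk_def)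
  then show False using simplicial_tree by (auto simp: simplicial_tree_def)
qed

end

section \<open>Distances from a vertex in the realization\<close>

definition edge_pt :: "'a \<Rightarrow> 'a \<Rightarrow> real \<Rightarrow> 'a \<Rightarrow> real" where
  "edge_pt a b s = (\<lambda>c. if c = a then 1 - s else if c = b then s else 0)"

text \<open>The affine extension of the graph distance from \<open>u\<close> to the whole realization. In a tree it is
  the metric distance from the vertex \<open>u\<close>; being a finite sum, it turns questions about the
  infimum in \<^const>\<open>tree_dist\<close> into linear arithmetic.\<close>

definition height :: "'a set \<Rightarrow> 'a set set \<Rightarrow> 'a \<Rightarrow> ('a \<Rightarrow> real) \<Rightarrow> real" where
  "height V E u x = (\<Sum>a\<in>supp x. x a * real (gdist V E u a))"

context tree
begin

lemma vertex_pt_in_realization: "a \<in> V \<Longrightarrow> vertex_pt a \<in> realization V E"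
proof -
  have "supp (vertex_pt a) = {a}" by (auto simp: supp_def vertex_pt_def)
  then show "a \<in> V \<Longrightarrow> ?thesis" by (auto simp: realization_def simplices_def vertex_pt_def)
qed

lemma realization_on_edge:
  assumes "x \<in> realization V E" "supp x \<subseteq> {a, b}" "a \<noteq> b"
  shows "x = edge_pt a b (x b)" "0 \<le> x b" "x b \<le> 1"
proof -
  have "(\<Sum>c\<in>supp x. x c) = (\<Sum>c\<in>{a, b}. x c)"
    using assms(2) by (intro sum.mono_neutral_left) (auto simp: supp_def)
  then have "x a + x b = 1" using assms by (auto simp: realization_def)
  moreover have "0 \<le> x a" "0 \<le> x b" using assms by (auto simp: realization_def)
  moreover have "x c = 0" if "c \<notin> {a, b}" for c using assms(2) that by (auto simp: supp_def)
  ultimately show "x = edge_pt a b (x b)" "0 \<le> x b" "x b \<le> 1"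
    by (auto simp: edge_pt_def fun_eq_iff)
qed

lemma realization_on_vertex:
  assumes "x \<in> realization V E" "supp x \<subseteq> {a}"
  shows "x = vertex_pt a"
proof -
  have "(\<Sum>c\<in>supp x. x c) = (\<Sum>c\<in>{a}. x c)"
    using assms(2) by (intro sum.mono_neutral_left) (auto simp: supp_def)
  then have "x a = 1" using assms by (auto simp: realization_def)
  then show ?thesis using assms(2) by (auto simp: supp_def vertex_pt_def fun_eq_iff)
qed

text \<open>Every edge has an orientation away from \<open>u\<close>, since the levels of its ends differ by exactly 1.
  So on each edge the height grows with slope 1 in one of the two coordinates.\<close>

lemma realization_cases:
  assumes x: "x \<in> realization V E" and u: "u \<in> V"
  obtains (vertex) a where "a \<in> V" "x = vertex_pt a"
  | (edge) a b where "{a, b} \<in> E" "gdist V E u b = Suc (gdist V E u a)"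
      "0 < x b" "x b < 1" "x = edge_pt a b (x b)"
proof -
  have "supp x \<in> simplices V E" using x by (simp add: realization_def)
  then consider c where "c \<in> V" "supp x = {c}" | "supp x \<in> E" by (auto simp: simplices_def)
  then show thesis
  proof cases
    case 1
    then show thesis using vertex realization_on_vertex[OF x, of c] by auto
  next
    case 2
    have main: thesis if ab: "supp x = {a, b}" "gdist V E u a < gdist V E u b" for a b
    proof -
      have e: "{a, b} \<in> E" using 2 ab by simp
      note edge_x = realization_on_edge[OF x, of a b] edgeD[OF e]
      have "x b \<noteq> 0" "x a \<noteq> 0" using ab(1) by (auto simp: supp_def)
      moreover have "x a = 1 - x b" using edge_x ab(1) by (metis edge_pt_def order_refl)
      ultimately have "0 < x b" "x b < 1" using edge_x ab(1) by auto
      moreover have "gdist V E u b = Suc (gdist V E u a)"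
        using gdist_edge_le[OF u e] ab(2) by simp
      ultimately show thesis using edge[OF e] edge_x ab(1) by auto
    qed
    obtain a b where ab: "supp x = {a, b}" using edgeE[OF 2] .
    then have "gdist V E u a \<noteq> gdist V E u b" using gdist_adjacent_neq[OF u] 2 by metis
    then show thesis using main[of a b] main[of b a] ab
      by (metis insert_commute linorder_neqE_nat)
  qed
qed

lemma height_vertex_pt: "height V E u (vertex_pt a) = real (gdist V E u a)"
proof -
  have "supp (vertex_pt a) = {a}" by (auto simp: supp_def vertex_pt_def)
  then show ?thesis by (simp add: height_def vertex_pt_def)
qed

lemma height_edge_pt:
  assumes "a \<noteq> b"
  shows "height V E u (edge_pt a b s) = (1 - s) * real (gdist V E u a) + s * real (gdist V E u b)"
proof -
  have "height V E u (edge_pt a b s) = (\<Sum>c\<in>{a, b}. edge_pt a b s c * real (gdist V E u c))"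
    unfolding height_def by (rule sum.mono_neutral_left) (auto simp: supp_def edge_pt_def split: if_splits)
  then show ?thesis using assms by (simp add: edge_pt_def)
qed

lemma seg_length_edge_pt:
  assumes "a \<noteq> b"
  shows "seg_length (edge_pt a b s) (edge_pt a b t) = \<bar>s - t\<bar>"
proof -
  let ?x = "edge_pt a b s" and ?y = "edge_pt a b t"
  have "(\<Sum>c\<in>supp ?x \<union> supp ?y. \<bar>?x c - ?y c\<bar>) = (\<Sum>c\<in>{a, b}. \<bar>?x c - ?y c\<bar>)"
    by (rule sum.mono_neutral_left) (auto simp: supp_def edge_pt_def split: if_splits)
  then show ?thesis using assms by (simp add: seg_length_def edge_pt_def)
qed

lemma edge_pt_0: "edge_pt a b 0 = vertex_pt a"
  and edge_pt_1: "a \<noteq> b \<Longrightarrow> edge_pt a b 1 = vertex_pt b"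
  by (auto simp: edge_pt_def vertex_pt_def fun_eq_iff)

lemma seg_length_nonneg: "0 \<le> seg_length x y"
  by (simp add: seg_length_def sum_nonneg)

text \<open>The height is affine on every simplex, and along an edge its slope is at most 1 in absolute
  value. Summed over a chain this makes the height difference a lower bound for the length.\<close>

lemma height_Lipschitz:
  assumes u: "u \<in> V" and x: "x \<in> realization V E" and y: "y \<in> realization V E"
    and "common_simplex V E x y"
  shows "height V E u y - height V E u x \<le> seg_length x y"
proof -
  obtain \<sigma> where \<sigma>: "\<sigma> \<in> simplices V E" "supp x \<subseteq> \<sigma>" "supp y \<subseteq> \<sigma>"
    using assms(4) by (auto simp: common_simplex_def)
  consider c where "\<sigma> = {c}" | "\<sigma> \<in> E" using \<sigma>(1) by (auto simp: simplices_def)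
  then show ?thesis
  proof cases
    case 1
    then have "x = y" using realization_on_vertex[OF x] realization_on_vertex[OF y] \<sigma> by metis
    then show ?thesis by (simp add: seg_length_nonneg)
  next
    case 2
    obtain a b where ab: "\<sigma> = {a, b}" using edgeE[OF 2] .
    then have e: "{a, b} \<in> E" and e': "{b, a} \<in> E" using 2 by (auto simp: insert_commute)
    have "a \<noteq> b" using edgeD[OF e] by simp
    obtain s t where xy: "x = edge_pt a b s" "y = edge_pt a b t"
      using realization_on_edge(1)[OF x _ \<open>a \<noteq> b\<close>] realization_on_edge(1)[OF y _ \<open>a \<noteq> b\<close>] \<sigma> ab by metis
    let ?D = "\<lambda>c. real (gdist V E u c)"
    have D: "\<bar>?D b - ?D a\<bar> \<le> 1" using gdist_edge_le[OF u e] gdist_edge_le[OF u e'] by linarith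
    have "height V E u y - height V E u x = (t - s) * (?D b - ?D a)"
      by (simp add: xy height_edge_pt[OF \<open>a \<noteq> b\<close>] algebra_simps)
    also have "\<dots> \<le> \<bar>t - s\<bar> * \<bar>?D b - ?D a\<bar>" by (metis abs_ge_self abs_mult)
    also have "\<dots> \<le> \<bar>t - s\<bar>" using D by (simp add: mult_left_le)
    finally show ?thesis by (simp add: xy seg_length_edge_pt[OF \<open>a \<noteq> b\<close>] abs_minus_commute)
  qed
qed

lemma chain_length_snoc:
  assumes "p \<noteq> []"
  shows "chain_length (p @ [y]) = chain_length p + seg_length (last p) y"
proof -
  obtain n where n: "length p = Suc n" using assms by (cases p) auto
  then have "(\<Sum>i<n. seg_length ((p @ [y]) ! i) ((p @ [y]) ! Suc i)) = (\<Sum>i<n. seg_length (p ! i) (p ! Suc i))"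
    by (intro sum.cong) (auto simp: nth_append)
  then show ?thesis using n assms by (simp add: chain_length_def nth_append last_conv_nth)
qed

lemma height_le_chain_length:
  assumes "u \<in> V" "chain V E x y p"
  shows "height V E u y - height V E u x \<le> chain_length p"
  using assms(2)
proof (induction p arbitrary: y rule: rev_induct)
  case Nil
  then show ?case by (simp add: chain_def)
next
  case (snoc z p)
  show ?case
  proof (cases "p = []")
    case True
    then show ?thesis using snoc.prems by (auto simp: chain_def chain_length_def)
  next
    case False
    have "chain V E x (last p) p" using snoc.prems False
      by (auto simp: chain_def successively_append_iff)
    from snoc.IH[OF this]
    have "height V E u (last p) - height V E u x \<le> chain_length p" .
    moreover have "height V E u y - height V E u (last p) \<le> seg_length (last p) y"
      using snoc.prems False
      by (intro height_Lipschitz[OF assms(1)]) (auto simp: chain_def successively_append_iff)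
    ultimately show ?thesis using snoc.prems False by (auto simp: chain_length_snoc chain_def)
  qed
qed

lemma chain_snoc_edge:
  assumes p: "chain V E x (vertex_pt a) p" and e: "{a, b} \<in> E" 
    and y: "edge_pt a b s \<in> realization V E" "0 \<le> s"
  shows "chain V E x (edge_pt a b s) (p @ [edge_pt a b s])"
    and "chain_length (p @ [edge_pt a b s]) = chain_length p + s"
proof -
  have "common_simplex V E (vertex_pt a) (edge_pt a b s)"
    unfolding common_simplex_def
    by (rule bexI[of _ "{a, b}"]) (use e in \<open>auto simp: supp_def vertex_pt_def edge_pt_def simplices_def split: if_splits\<close>)
  then show "chain V E x (edge_pt a b s) (p @ [edge_pt a b s])"
    using p y by (auto simp: chain_def successively_append_iff)
  have "seg_length (vertex_pt a) (edge_pt a b s) = s"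
    using seg_length_edge_pt[of a b 0 s] edgeD[OF e] edge_pt_0[of a b] y(2) by simp
  then show "chain_length (p @ [edge_pt a b s]) = chain_length p + s"
    using p by (auto simp: chain_def chain_length_snoc)
qed

lemma chain_to_vertex:
  assumes "u \<in> V" "a \<in> V"
  shows "\<exists>p. chain V E (vertex_pt u) (vertex_pt a) p \<and> chain_length p = real (gdist V E u a)"
  using assms(2)
proof (induction "gdist V E u a" arbitrary: a)
  case 0
  then have "a = u" using gdist_eq_0[OF assms(1)] by simp
  then show ?case using 0 vertex_pt_in_realization
    by (intro exI[of _ "[vertex_pt u]"]) (auto simp: chain_def chain_length_def)
next
  case (Suc n)
  obtain b where b: "{b, a} \<in> E" "gdist V E u b = n"
    using gdist_parent[OF assms(1) Suc.prems] Suc.hyps(2) by metis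
  obtain p where p: "chain V E (vertex_pt u) (vertex_pt b) p" "chain_length p = real n"
    using Suc.hyps(1)[of b] b edgeD[OF b(1)] by auto
  show ?case
    using chain_snoc_edge[OF p(1) b(1), of 1] p(2) Suc.hyps(2)[symmetric] vertex_pt_in_realization[OF Suc.prems]
    by (auto simp: edge_pt_1[OF edgeD(3)[OF b(1)]])
qed

text \<open>The chain through the vertices of a shortest walk attains the lower bound given by the height:
  a point inside an edge is entered through the end that is closer to \<open>u\<close>.\<close>

lemma chain_to_point:
  assumes "u \<in> V" "x \<in> realization V E"
  shows "\<exists>p. chain V E (vertex_pt u) x p \<and> chain_length p = height V E u x"
  using assms(2,1)
proof (cases rule: realization_cases)
  case (vertex a)
  then show ?thesis using chain_to_vertex[OF assms(1)] by (simp add: height_vertex_pt)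
next
  case (edge a b)
  obtain p where p: "chain V E (vertex_pt u) (vertex_pt a) p" "chain_length p = real (gdist V E u a)"
    using chain_to_vertex[OF assms(1) edgeD(1)[OF edge(1)]] by blast
  have "height V E u x = real (gdist V E u a) + x b"
    by (subst edge(5)) (simp add: height_edge_pt[OF edgeD(3)[OF edge(1)]] edge(2) algebra_simps)
  moreover have "chain V E (vertex_pt u) x (p @ [x])" "chain_length (p @ [x]) = chain_length p + x b"
    using chain_snoc_edge[OF p(1) edge(1), of "x b"] edge(3,5) assms(2) by auto
  ultimately show ?thesis using p(2) by auto
qed

lemma tree_dist_vertex:
  assumes "u \<in> V" "x \<in> realization V E"
  shows "tree_dist V E (vertex_pt u) x = height V E u x"
  unfolding tree_dist_def
proof (rule cInf_eq_minimum)
  show "height V E u x \<in> {chain_length p | p. chain V E (vertex_pt u) x p}"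
    using chain_to_point[OF assms] by (metis (mono_tags, lifting) mem_Collect_eq)
next
  fix l assume "l \<in> {chain_length p | p. chain V E (vertex_pt u) x p}"
  then show "height V E u x \<le> l"
    using height_le_chain_length[OF assms(1), of "vertex_pt u" x] gdist_self[OF assms(1)]
    by (auto simp: height_vertex_pt)
qed

lemma tree_dist_vertices:
  "u \<in> V \<Longrightarrow> a \<in> V \<Longrightarrow> tree_dist V E (vertex_pt u) (vertex_pt a) = real (gdist V E u a)"
  by (simp add: tree_dist_vertex vertex_pt_in_realization height_vertex_pt)

section \<open>Ends as combinatorial rays\<close>

text \<open>The key step: ends are combinatorial. The height of \<open>f t\<close> over the root is \<open>t\<close>, so \<open>f\<close> passes
  through a vertex exactly at the integer times. Between the times \<open>n\<close> and \<open>n + 1\<close>, the point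
  \<open>f (n + s)\<close> lies inside an edge of the right levels at distance less than 1 from both vertices
  \<open>w n\<close> and \<open>w (n + 1)\<close>. A vertex which is not an end of an edge has distance at least 1 from all
  points of that edge, so that edge joins these two vertices.\<close>

lemma end_space_ray:
  assumes v: "v \<in> V" and f: "f \<in> end_space V E v"
  obtains w where "\<And>n. {w n, w (Suc n)} \<in> E" "\<And>n. gdist V E v (w n) = n"
    "\<And>n s. 0 \<le> s \<Longrightarrow> s \<le> 1 \<Longrightarrow> f (real n + s) = edge_pt (w n) (w (Suc n)) s"
proof -
  have f0: "f 0 = vertex_pt v" using f by (simp add: end_space_def)
  have fR: "f t \<in> realization V E" if "0 \<le> t" for t
    using f that by (auto simp: end_space_def isometric_embeddings_def)
  have f_dist: "tree_dist V E (f s) (f t) = \<bar>s - t\<bar>" if "0 \<le> s" "0 \<le> t" for s t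
    using f that by (auto simp: end_space_def isometric_embeddings_def)
  have f_height: "height V E v (f t) = t" if "0 \<le> t" for t
    using f_dist[of 0 t] tree_dist_vertex[OF v fR[OF that]] that f0 by simp
  have "\<exists>a\<in>V. f (real n) = vertex_pt a" for n
  proof -
    have "f (real n) \<in> realization V E" by (simp add: fR)
    then show ?thesis
    proof (cases rule: realization_cases[OF _ v, consumes 1, case_names vertex edge])
      case (vertex a)
      then show ?thesis by blast
    next
      case (edge a b)
      have "height V E v (f (real n)) = real (gdist V E v a) + f (real n) b"
        by (subst edge(5)) (simp add: height_edge_pt[OF edgeD(3)[OF edge(1)]] edge(2) algebra_simps)
      then have "real n = real (gdist V E v a) + f (real n) b" by (simp add: f_height)
      then have "gdist V E v a < n" "n < Suc (gdist V E v a)"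
        using edge(3,4) by linarith+
      then have False by simp
      then show ?thesis ..
    qed
  qed
  then obtain w where wV: "\<And>n. w n \<in> V" and fw: "\<And>n. f (real n) = vertex_pt (w n)" by metis
  have level: "gdist V E v (w n) = n" for n
    using f_height[of "real n"] by (simp add: fw height_vertex_pt)
  have edge_w: "{w n, w (Suc n)} \<in> E" for n
  proof -
    have "gdist V E (w n) (w (Suc n)) = Suc 0"
      using f_dist[of "real n" "real (Suc n)"] tree_dist_vertices[OF wV wV, of n "Suc n"]
      by (simp add: fw[symmetric])
    then obtain a where "{a, w (Suc n)} \<in> E" "gdist V E (w n) a = 0"
      using gdist_parent[OF wV wV] by metis
    then show ?thesis using gdist_eq_0[OF wV] edgeD by metis
  qed
  \<comment> \<open>On the edge the height over \<open>c\<close> is a convex combination of two nonzero graph distances.\<close>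
  have far: "1 \<le> height V E c (edge_pt a b s)"
    if c: "c \<in> V" "c \<noteq> a" "c \<noteq> b" and e: "{a, b} \<in> E" and s: "0 \<le> s" "s \<le> 1" for a b c s
  proof -
    have "gdist V E c a \<noteq> 0" "gdist V E c b \<noteq> 0"
      using gdist_eq_0 edgeD[OF e] c by metis+
    then have "1 - s \<le> (1 - s) * real (gdist V E c a)" "s \<le> s * real (gdist V E c b)"
      using s by (auto intro: mult_left_le simp: mult_le_cancel_left1)
    then show ?thesis by (simp add: height_edge_pt[OF edgeD(3)[OF e]])
  qed
  have "f (real n + s) = edge_pt (w n) (w (Suc n)) s" if s: "0 \<le> s" "s \<le> 1" for n s
  proof -
    consider "s = 0" | "s = 1" | "0 < s" "s < 1" using s by linarith
    then show ?thesis
    proof cases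
      case 1
      then show ?thesis by (simp add: fw edge_pt_0)
    next
      case 2
      then show ?thesis using fw[of "Suc n"] edgeD(3)[OF edge_w] by (simp add: edge_pt_1 add.commute)
    next
      case 3
      define x where "x = f (real n + s)"
      have x: "x \<in> realization V E" using s by (simp add: x_def fR)
      have height_x: "height V E v x = real n + s" using s by (simp add: x_def f_height)
      show ?thesis
        using x v
      proof (cases rule: realization_cases)
        case (vertex a)
        then have "real (gdist V E v a) = real n + s" using height_x by (simp add: height_vertex_pt)
        then have "n < gdist V E v a" "gdist V E v a < Suc n"
          using 3 by linarith+
        then have False by simp
        then show ?thesis ..
      next
        case (edge a b)
        have "height V E v x = real (gdist V E v a) + x b"
          by (subst edge(5)) (simp add: height_edge_pt[OF edgeD(3)[OF edge(1)]] edge(2) algebra_simps)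
        then have eq: "real n + s = real (gdist V E v a) + x b" by (simp add: height_x)
        then have a_level: "gdist V E v a = n" using 3 edge(3,4) by linarith
        then have "x b = s" using eq by simp
        have "height V E (w n) x = s"
          using f_dist[of "real n" "real n + s"] s tree_dist_vertex[OF wV x] by (simp add: x_def fw)
        then have "w n = a"
          using far[OF wV _ _ edge(1), of n "x b"] edge(2-5) 3 a_level level[of n] by fastforce
        have "height V E (w (Suc n)) x = 1 - s"
          using f_dist[of "real (Suc n)" "real n + s"] s tree_dist_vertex[OF wV x, of "Suc n"]
            fw[of "Suc n"] by (simp add: x_def)
        then have "w (Suc n) = b"
          using far[OF wV _ _ edge(1), of "Suc n" "x b"] edge(2-5) 3 a_level level[of "Suc n"] by fastforce
        show ?thesis using edge(5) \<open>w n = a\<close> \<open>w (Suc n) = b\<close> \<open>x b = s\<close> by (simp add: x_def)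
      qed
    qed
  qed
  then show thesis using that[OF edge_w level] by blast
qed

text \<open>A point in the interior of an edge or at its upper end determines the upper end, and each vertex
  of a tree determines all its ancestors. So two ends that meet at time \<open>t\<close> agree until the next
  integer time: they can separate only at vertices.\<close>

lemma ends_agree_up_to_ceiling:
  assumes v: "v \<in> V" and f: "f \<in> end_space V E v" and g: "g \<in> end_space V E v"
    and "0 \<le> t" "f t = g t" "0 \<le> s" "s \<le> real_of_int \<lceil>t\<rceil>"
  shows "f s = g s"
proof (cases "s = 0")
  case True
  then show ?thesis using f g by (simp add: end_space_def)
next
  case False
  \<comment> \<open>With \<open>\<sigma>\<close> in the half-open interval \<open>(0, 1]\<close> an integer time counts as the upper end of an
    edge, whose coordinate \<open>\<sigma>\<close> is then nonzero.\<close>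
  have split: "\<exists>n \<sigma>. r = real n + \<sigma> \<and> 0 < \<sigma> \<and> \<sigma> \<le> 1" if "0 < r" for r :: real
    by (rule exI[of _ "nat (\<lceil>r\<rceil> - 1)"], rule exI[of _ "r - real (nat (\<lceil>r\<rceil> - 1))"])
      (use that in \<open>simp; linarith\<close>)
  obtain w where w: "\<And>n. {w n, w (Suc n)} \<in> E" "\<And>n. gdist V E v (w n) = n"
    "\<And>n s. 0 \<le> s \<Longrightarrow> s \<le> 1 \<Longrightarrow> f (real n + s) = edge_pt (w n) (w (Suc n)) s"
    using end_space_ray[OF v f] by blast
  obtain w' where w': "\<And>n. {w' n, w' (Suc n)} \<in> E" "\<And>n. gdist V E v (w' n) = n"
    "\<And>n s. 0 \<le> s \<Longrightarrow> s \<le> 1 \<Longrightarrow> g (real n + s) = edge_pt (w' n) (w' (Suc n)) s"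
    using end_space_ray[OF v g] by blast
  have "0 < t" using assms(4,6,7) False by (cases "t = 0") auto
  then obtain n \<tau> where t: "t = real n + \<tau>" "0 < \<tau>" "\<tau> \<le> 1" using split by blast
  \<comment> \<open>Of the two vertices with nonzero coordinate in the common point, the higher one is the same
    for both rays.\<close>
  have "edge_pt (w n) (w (Suc n)) \<tau> (w (Suc n)) = edge_pt (w' n) (w' (Suc n)) \<tau> (w (Suc n))"
    using w(3)[of \<tau> n] w'(3)[of \<tau> n] t assms(5) by simp
  moreover have "w (Suc n) \<noteq> w n" "w (Suc n) \<noteq> w' n" using w(2) w'(2) by (metis n_not_Suc_n)+
  ultimately have top: "w (Suc n) = w' (Suc n)"
    using t(2) by (auto simp: edge_pt_def split: if_splits)
  have down: "w m = w' m" if "m \<le> Suc n" for m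
    using that
  proof (induction m rule: inc_induct)
    case base
    then show ?case by (rule top)
  next
    case (step m)
    have "{w' m, w (Suc m)} \<in> E" using w'(1)[of m] step.IH by simp
    then show ?case using parent_unique[OF v w(1)[of m] \<open>{w' m, w (Suc m)} \<in> E\<close>] w(2) w'(2) by simp
  qed
  obtain m \<sigma> where s: "s = real m + \<sigma>" "0 < \<sigma>" "\<sigma> \<le> 1"
    using split[of s] assms(6) False by auto
  have "\<lceil>t\<rceil> \<le> int n + 1" using t by linarith
  then have "real m < real (Suc n)" using s assms(7) by linarith
  then have "m \<le> n" by simp
  then show ?thesis using down[of m] down[of "Suc m"] w(3) w'(3) s by simp
qed

section \<open>The metric on the end space\<close>

lemma end_dist_branch:
  assumes v: "v \<in> V" and f: "f \<in> end_space V E v" and g: "g \<in> end_space V E v" and "f \<noteq> g"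
  obtains N :: nat where "end_dist f g = exp (- real N)"
    "\<And>t. 0 \<le> t \<Longrightarrow> f t = g t \<longleftrightarrow> t \<le> real N"
proof -
  have "f \<in> extensional {0..}" "g \<in> extensional {0..}"
    using f g by (auto simp: end_space_def isometric_embeddings_def PiE_def)
  then obtain t0 where t0: "0 \<le> t0" "f t0 \<noteq> g t0"
    using \<open>f \<noteq> g\<close> by (meson atLeast_iff extensionalityI)
  \<comment> \<open>The branching time is the largest integer time at which the ends agree.\<close>
  define S where "S = {n :: nat. f (real n) = g (real n)}"
  have "n \<le> nat \<lceil>t0\<rceil>" if "n \<in> S" for n
  proof (rule ccontr)
    assume "\<not> ?thesis"
    then have "t0 \<le> real n" by linarith
    then show False using ends_agree_up_to_ceiling[OF v f g, of "real n" t0] that t0 by (simp add: S_def)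
  qed
  then have finS: "finite S" using finite_nat_set_iff_bounded_le by blast
  have "0 \<in> S" using f g by (simp add: S_def end_space_def)
  define N where "N = Max S"
  have "N \<in> S" using finS \<open>0 \<in> S\<close> unfolding N_def by (intro Max_in) auto
  have iff: "f t = g t \<longleftrightarrow> t \<le> real N" if "0 \<le> t" for t
  proof
    assume "f t = g t"
    then have "f (real_of_int \<lceil>t\<rceil>) = g (real_of_int \<lceil>t\<rceil>)"
      using ends_agree_up_to_ceiling[OF v f g that] that by simp
    then have "nat \<lceil>t\<rceil> \<in> S" using that by (simp add: S_def)
    then have "nat \<lceil>t\<rceil> \<le> N" using finS unfolding N_def by (intro Max_ge)
    then show "t \<le> real N" by linarith
  next
    assume "t \<le> real N"
    then show "f t = g t"
      using ends_agree_up_to_ceiling[OF v f g, of "real N" t] \<open>N \<in> S\<close> that by (simp add: S_def)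
  qed
  have "{t. 0 \<le> t \<and> f t = g t} = {0..real N}" using iff by auto
  then have "end_dist f g = exp (- real N)" using \<open>f \<noteq> g\<close> by (simp add: end_dist_def)
  then show thesis using that iff by blast
qed

text \<open>In this form the ultrametric inequality is the transitivity of agreement on \<open>[0, n]\<close>.\<close>

lemma end_dist_le_iff:
  assumes v: "v \<in> V" and f: "f \<in> end_space V E v" and g: "g \<in> end_space V E v"
  shows "end_dist f g \<le> exp (- real n) \<longleftrightarrow> (\<forall>t. 0 \<le> t \<and> t \<le> real n \<longrightarrow> f t = g t)"
proof (cases "f = g")
  case True
  then show ?thesis by (simp add: end_dist_def)
next
  case False
  obtain N where N: "end_dist f g = exp (- real N)" "\<And>t. 0 \<le> t \<Longrightarrow> f t = g t \<longleftrightarrow> t \<le> real N"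
    using end_dist_branch[OF v f g False] by blast
  show ?thesis
  proof
    assume "end_dist f g \<le> exp (- real n)"
    then show "\<forall>t. 0 \<le> t \<and> t \<le> real n \<longrightarrow> f t = g t" using N by auto
  next
    assume "\<forall>t. 0 \<le> t \<and> t \<le> real n \<longrightarrow> f t = g t"
    then have "f (real n) = g (real n)" by simp
    then show "end_dist f g \<le> exp (- real n)" using N by simp
  qed
qed

lemma ultrametric_end_space:
  assumes v: "v \<in> V"
  shows "ultrametric_space (end_space V E v) end_dist"
proof -
  let ?X = "end_space V E v"
  have nonneg: "0 \<le> end_dist f g" for f g :: "real \<Rightarrow> 'a \<Rightarrow> real" by (simp add: end_dist_def)
  have ultra: "end_dist f g \<le> max (end_dist f h) (end_dist h g)"
    if f: "f \<in> ?X" and g: "g \<in> ?X" and h: "h \<in> ?X" for f g h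
  proof (cases "f = h \<or> h = g")
    case True
    then show ?thesis by auto
  next
    case False
    obtain M where M: "end_dist f h = exp (- real M)" 
      using end_dist_branch[OF v f h] False by blast
    obtain N where N: "end_dist h g = exp (- real N)" 
      using end_dist_branch[OF v h g] False by blast
    have le: "end_dist f h \<le> exp (- real (min M N))" "end_dist h g \<le> exp (- real (min M N))"
      using M N by simp_all
    have "end_dist f g \<le> exp (- real (min M N))"
      using le unfolding end_dist_le_iff[OF v f h] end_dist_le_iff[OF v h g] end_dist_le_iff[OF v f g]
      by simp
    also have "\<dots> = max (end_dist f h) (end_dist h g)"
      by (simp add: M N min_def max_def)
    finally show ?thesis .
  qed
  have "Metric_space ?X end_dist"
  proof
    show "0 \<le> end_dist f g" for f g :: "real \<Rightarrow> 'a \<Rightarrow> real" by (rule nonneg)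
    show "end_dist f g = end_dist g f" for f g :: "real \<Rightarrow> 'a \<Rightarrow> real"
      by (simp add: end_dist_def eq_commute)
    show "end_dist f g = 0 \<longleftrightarrow> f = g" if "f \<in> ?X" "g \<in> ?X" for f g
      by (simp add: end_dist_def)
    show "end_dist f h \<le> end_dist f g + end_dist g h" if "f \<in> ?X" "g \<in> ?X" "h \<in> ?X" for f g h
      using ultra[OF that(1,3,2)] nonneg[of f g] nonneg[of g h] by linarith
  qed
  then show ?thesis using ultra by (simp add: ultrametric_space_def)
qed

text \<open>On \<open>[0, k]\<close> a Cauchy sequence of ends is eventually constant. The limit is glued from these
  constant pieces, and it is isometric because any two of its points lie on a common end of the
  sequence.\<close>

lemma mcomplete_end_space:
  assumes v: "v \<in> V"
  shows "Metric_space.mcomplete (end_space V E v) end_dist"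
proof -
  let ?X = "end_space V E v"
  interpret Metric_space ?X end_dist using ultrametric_end_space[OF v] by (simp add: ultrametric_space_def)
  show ?thesis
    unfolding mcomplete_def
  proof (intro allI impI)
    fix \<sigma> assume "MCauchy \<sigma>"
    then have \<sigma>X: "\<sigma> n \<in> ?X" for n by (auto simp: MCauchy_def)
    have "\<exists>N. \<forall>n\<ge>N. \<forall>n'\<ge>N. end_dist (\<sigma> n) (\<sigma> n') < exp (- real k)" for k
      using \<open>MCauchy \<sigma>\<close> unfolding MCauchy_def by (metis exp_gt_zero)
    then obtain N where N: "\<And>k n n'. N k \<le> n \<Longrightarrow> N k \<le> n' \<Longrightarrow> end_dist (\<sigma> n) (\<sigma> n') < exp (- real k)"
      by metis
    have agree: "\<sigma> n t = \<sigma> n' t" if "N k \<le> n" "N k \<le> n'" "0 \<le> t" "t \<le> real k" for k n n' t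
      using end_dist_le_iff[OF v \<sigma>X \<sigma>X, of n n' k] N[OF that(1,2)] that(3,4) by simp
    define g where "g t = (if 0 \<le> t then \<sigma> (N (nat \<lceil>t\<rceil>)) t else undefined)" for t
    have g_eq: "g t = \<sigma> n t" if "0 \<le> t" "t \<le> real k" "N k \<le> n" for t k n
    proof -
      let ?m = "max n (N (nat \<lceil>t\<rceil>))"
      have "\<sigma> (N (nat \<lceil>t\<rceil>)) t = \<sigma> ?m t" using that by (intro agree[of "nat \<lceil>t\<rceil>"]) auto
      also have "\<dots> = \<sigma> n t" using that by (intro agree[of k]) auto
      finally show ?thesis using that by (simp add: g_def)
    qed
    have iso: "\<sigma> n t \<in> realization V E" "tree_dist V E (\<sigma> n s) (\<sigma> n t) = \<bar>s - t\<bar>" "\<sigma> n 0 = vertex_pt v"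
      if "0 \<le> s" "0 \<le> t" for n s t
      using \<sigma>X[of n] that by (auto simp: end_space_def isometric_embeddings_def)
    have "g \<in> ?X"
      unfolding end_space_def isometric_embeddings_def
    proof (intro CollectI conjI ballI)
      show "g \<in> {0..} \<rightarrow>\<^sub>E realization V E" using iso(1) by (auto simp: g_def)
      show "g 0 = vertex_pt v" using iso(3)[of 0 0] by (simp add: g_def)
      fix s t :: real assume "s \<in> {0..}" "t \<in> {0..}"
      moreover define k where "k = nat \<lceil>max s t\<rceil>"
      moreover have "s \<le> real k" "t \<le> real k" unfolding k_def by linarith+
      ultimately show "tree_dist V E (g s) (g t) = \<bar>s - t\<bar>"
        using g_eq[of s k "N k"] g_eq[of t k "N k"] iso(2) by simp
    qed
    moreover have "\<exists>M. \<forall>n\<ge>M. \<sigma> n \<in> ?X \<and> end_dist (\<sigma> n) g < \<epsilon>" if "0 < \<epsilon>" for \<epsilon>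
    proof -
      obtain k :: nat where "- ln \<epsilon> < real k" using reals_Archimedean2 by blast
      then have "exp (- real k) < \<epsilon>" using that by (metis exp_less_cancel_iff exp_ln minus_less_iff)
      moreover have "end_dist (\<sigma> n) g \<le> exp (- real k)" if "N k \<le> n" for n
        using end_dist_le_iff[OF v \<sigma>X \<open>g \<in> ?X\<close>] g_eq[of _ k n] that by simp
      ultimately show ?thesis using \<sigma>X by (meson order_le_less_trans)
    qed
    ultimately show "\<exists>x. limitin mtopology \<sigma> x sequentially"
      unfolding limit_metric_sequentially by blast
  qed
qed

text \<open>Nonzero distances are of the form \<open>exp (- N)\<close> with \<open>N\<close> a natural number.\<close>

lemma finite_large_end_dists:
  assumes v: "v \<in> V" and "0 < \<epsilon>"
  shows "finite {r. \<epsilon> \<le> r \<and> (\<exists>f\<in>end_space V E v. \<exists>g\<in>end_space V E v. r = end_dist f g)}"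
proof (rule finite_subset)
  show "finite ((\<lambda>N. exp (- real N)) ` {..nat \<lceil>- ln \<epsilon>\<rceil>})" by simp
  show "{r. \<epsilon> \<le> r \<and> (\<exists>f\<in>end_space V E v. \<exists>g\<in>end_space V E v. r = end_dist f g)}
      \<subseteq> (\<lambda>N. exp (- real N)) ` {..nat \<lceil>- ln \<epsilon>\<rceil>}"
  proof clarify
    fix f g assume fg: "f \<in> end_space V E v" "g \<in> end_space V E v" and ge: "\<epsilon> \<le> end_dist f g"
    have "f \<noteq> g" using ge \<open>0 < \<epsilon>\<close> by (auto simp: end_dist_def)
    obtain N where N: "end_dist f g = exp (- real N)" 
      using end_dist_branch[OF v fg \<open>f \<noteq> g\<close>] by blast
    then have "ln \<epsilon> \<le> - real N" using ge \<open>0 < \<epsilon>\<close> by (metis exp_gt_zero ln_exp ln_le_cancel_iff)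
    then have "N \<le> nat \<lceil>- ln \<epsilon>\<rceil>" by linarith
    then show "end_dist f g \<in> (\<lambda>N. exp (- real N)) ` {..nat \<lceil>- ln \<epsilon>\<rceil>}" using N by simp
  qed
qed

end

theorem corollary2p24:
  fixes V :: "'a set" and E :: "'a set set" and v :: 'a
  assumes "simplicial_tree V E"
    and "v \<in> V"
    and "geodesically_complete V E v"
    and "\<exists>f \<in> end_space V E v. \<exists>g \<in> end_space V E v. f \<noteq> g"
  shows "ultrametric_space (end_space V E v) end_dist \<and>
         pseudo_complete (end_space V E v) end_dist"
proof -
  interpret tree V E by unfold_locales (rule assms(1))
  note um = ultrametric_end_space[OF assms(2)]
  then show ?thesis
    using pseudo_complete_if_complete_discrete[OF um mcomplete_end_space[OF assms(2)]
        finite_large_end_dists[OF assms(2)]] by blast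
qed

end
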